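(* Let $p,q,r$ be real numbers with $p<q$, $q>0$ and $r>0$ ($p$ may be positive, zero or negative), and let $ABC$ be the triangle with vertices $A=(0,r)$, $B=(p,0)$, $C=(q,0)$. Then for every interior point $M$ of the triangle $ABC$, $$R_A+R_B+R_C\;\ge\;\frac{3}{2}\,(r_a+r_b+r_c),$$ where $R_A,R_B,R_C$ are the taxicab distances from $M$ to the vertices $A,B,C$, and $r_a,r_b,r_c$ are the taxicab distances from $M$ to the lines $BC$, $AC$, $AB$ respectively.
   Context: The taxicab distance between points $(x_1,y_1)$ and $(x_2,y_2)$ of the plane is $d_1=|x_1-x_2|+|y_1-y_2|$. The taxicab distance of a point $(x_0,y_0)$ to the line $ax+by+c=0$ is $\frac{|ax_0+by_0+c|}{\max\{|a|,|b|\}}$. Explicitly, for $M=(x,y)$: $R_A=|x|+|y-r|$, $R_B=|x-p|+|y|$, $R_C=|x-q|+|y|$, $r_a=|y|$, $r_b=\frac{|qr-rx-qy|}{\max\{|r|,|q|\}}$, $r_c=\frac{|pr-rx-py|}{\max\{|r|,|p|\}}$. *)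

theory Defs
  imports "HOL-Analysis.Analysis"
begin

definition taxi_dist :: "real \<times> real \<Rightarrow> real \<times> real \<Rightarrow> real" where
  "taxi_dist P Q = \<bar>fst P - fst Q\<bar> + \<bar>snd P - snd Q\<bar>"

text \<open>Taxicab distance of the point \<open>M\<close> to the line \<open>a x + b y + c = 0\<close>.\<close>

definition taxi_dist_eqn :: "real \<Rightarrow> real \<Rightarrow> real \<Rightarrow> real \<times> real \<Rightarrow> real" where
  "taxi_dist_eqn a b c M = \<bar>a * fst M + b * snd M + c\<bar> / max \<bar>a\<bar> \<bar>b\<bar>"

text \<open>Taxicab distance of \<open>M\<close> to the line \<open>PQ\<close>, for \<open>P \<noteq> Q\<close>. The coefficients are those of the
  two-point equation of the line (lemma \<open>affine_hull_line_eqn\<close>); the quotient does not depend on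
  the scaling of the equation.\<close>

definition taxi_dist_line :: "real \<times> real \<Rightarrow> real \<times> real \<Rightarrow> real \<times> real \<Rightarrow> real" where
  "taxi_dist_line M P Q =
     taxi_dist_eqn (snd P - snd Q) (fst Q - fst P) (fst P * snd Q - fst Q * snd P) M"

lemma taxi_dist_eqn_scale:
  assumes "k \<noteq> 0"
  shows "taxi_dist_eqn (k * a) (k * b) (k * c) M = taxi_dist_eqn a b c M"
proof -
  have "k * a * fst M + k * b * snd M + k * c = k * (a * fst M + b * snd M + c)"
    by (simp add: algebra_simps)
  moreover have "max \<bar>k * a\<bar> \<bar>k * b\<bar> = \<bar>k\<bar> * max \<bar>a\<bar> \<bar>b\<bar>"
    by (simp add: abs_mult max_mult_distrib_left)
  ultimately show ?thesis
    using assms by (simp add: taxi_dist_eqn_def abs_mult)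
qed

lemma affine_hull_line_eqn:
  fixes P Q :: "real \<times> real"
  assumes "P \<noteq> Q"
  shows "affine hull {P, Q} =
    {(x, y). (snd P - snd Q) * x + (fst Q - fst P) * y + (fst P * snd Q - fst Q * snd P) = 0}"
    (is "_ = ?L")
proof (intro set_eqI iffI)
  fix X assume "X \<in> affine hull {P, Q}"
  then obtain u v where uv: "X = u *\<^sub>R P + v *\<^sub>R Q" "u + v = 1"
    by (auto simp: affine_hull_2)
  then have X: "fst X = u * fst P + (1 - u) * fst Q" "snd X = u * snd P + (1 - u) * snd Q"
    by (auto simp: algebra_simps simp flip: uv(2))
  show "X \<in> ?L"
    unfolding mem_Collect_eq case_prod_beta X by (simp add: algebra_simps)
next
  fix X assume X: "X \<in> ?L"
  define d where "d = Q - P"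
  have d: "fst d = fst Q - fst P" "snd d = snd Q - snd P"
    by (simp_all add: d_def)
  have e: "fst d * (snd X - snd P) = snd d * (fst X - fst P)"
    using X by (simp add: case_prod_beta d algebra_simps)
  have "fst d \<noteq> 0 \<or> snd d \<noteq> 0"
    using assms by (auto simp: d prod_eq_iff)
  then have "\<exists>t. fst X = fst P + t * fst d \<and> snd X = snd P + t * snd d"
  proof
    assume "fst d \<noteq> 0"
    then show ?thesis
      using e by (intro exI[of _ "(fst X - fst P) / fst d"]) (simp add: field_simps)
  next
    assume "snd d \<noteq> 0"
    then show ?thesis
      using e by (intro exI[of _ "(snd X - snd P) / snd d"]) (simp add: field_simps)
  qed
  then obtain t where "fst X = fst P + t * fst d" "snd X = snd P + t * snd d"
    by blast
  then have "X = (1 - t) *\<^sub>R P + t *\<^sub>R Q"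
    by (simp add: prod_eq_iff d algebra_simps)
  then show "X \<in> affine hull {P, Q}"
    unfolding affine_hull_2 by (intro CollectI exI[of _ "1 - t"] exI[of _ t]) simp
qed

lemma taxi_dist_line_triangle:
  fixes p q r x y :: real
  assumes "p < q"
  shows "taxi_dist_line (x, y) (p, 0) (q, 0) = \<bar>y\<bar>"
    and "taxi_dist_line (x, y) (0, r) (q, 0) = \<bar>q * r - r * x - q * y\<bar> / max \<bar>r\<bar> \<bar>q\<bar>"
    and "taxi_dist_line (x, y) (0, r) (p, 0) = \<bar>p * r - r * x - p * y\<bar> / max \<bar>r\<bar> \<bar>p\<bar>"
proof -
  have *: "\<bar>r * x + s * y - s * r\<bar> = \<bar>s * r - r * x - s * y\<bar>" for s
    by linarith
  show "taxi_dist_line (x, y) (p, 0) (q, 0) = \<bar>y\<bar>"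
    using assms by (simp add: taxi_dist_line_def taxi_dist_eqn_def abs_mult)
  show "taxi_dist_line (x, y) (0, r) (q, 0) = \<bar>q * r - r * x - q * y\<bar> / max \<bar>r\<bar> \<bar>q\<bar>"
    "taxi_dist_line (x, y) (0, r) (p, 0) = \<bar>p * r - r * x - p * y\<bar> / max \<bar>r\<bar> \<bar>p\<bar>"
    by (simp_all add: taxi_dist_line_def taxi_dist_eqn_def *)
qed

end

theory Submission
  imports Defs
begin

text \<open>In barycentric coordinates \<open>M = a A + b B + c C\<close> both sides become positively homogeneous
  in \<open>(a, b, c)\<close> and linear on each of the two cones into which the kink of the one remaining
  absolute value cuts the orthant. It therefore suffices to compare coefficients, i.e. to check the
  inequality on extreme rays. For \<open>p \<le> 0\<close> the kink is \<open>x = 0\<close> and the rays are \<open>B\<close>, \<open>C\<close> and the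
  foot of the altitude from \<open>A\<close>; for \<open>p > 0\<close> the bound \<open>\<bar>x - p\<bar> \<ge> x - p\<close> already suffices.\<close>

lemma mult_divide_max_self:
  fixes r t :: real
  assumes "r > 0" "t \<ge> 0"
  shows "t * (r / max r t) = min r t"
  using assms by (auto simp: max_def min_def field_simps)

lemma divide_max_le_1:
  fixes r t :: real
  assumes "r > 0"
  shows "r / max r t \<le> 1"
  using assms by (auto simp: max_def field_simps)

text \<open>With \<open>P = - p\<close> this is the inequality at the vertex \<open>B\<close>;
  swapping \<open>P\<close> and \<open>q\<close> gives the vertex \<open>C\<close>. It follows from
  \<open>r / max r q \<le> 1\<close> on the \<open>P\<close> part and
  \<open>min r q \<le> (r + q) / 2\<close> on the rest.\<close>

lemma base_vertex_bound:
  fixes P q r :: real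
  assumes "P \<ge> 0" "q \<ge> 0" "r > 0"
  shows "3 / 2 * ((P + q) * (r / max r q)) \<le> P + (r + (P + q))"
proof -
  have "(P + q) * (r / max r q) = P * (r / max r q) + min r q"
    using mult_divide_max_self[of r q] assms by (simp only: distrib_right)
  moreover have "P * (r / max r q) \<le> P"
    using divide_max_le_1[of r q] assms by (intro mult_left_le) auto
  ultimately show ?thesis
    using assms by (simp add: min_def split: if_splits)
qed

text \<open>The foot of the altitude from \<open>A\<close> is the origin, with weights proportional
  to \<open>q\<close> at \<open>B\<close> and \<open>P\<close> at \<open>C\<close>. After cancelling
  \<open>P + q\<close>, each minimum satisfies
  \<open>3 / 2 * min r t \<le> r / 2 + t\<close>.\<close>

lemma altitude_foot_bound:
  fixes P q r :: real
  assumes "P \<ge> 0" "q \<ge> 0" "r > 0"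
  shows "3 / 2 * (q * ((P + q) * (r / max r q)) + P * ((P + q) * (r / max r P)))
    \<le> (P + q) * (r + (P + q))"
proof -
  have "q * ((P + q) * (r / max r q)) + P * ((P + q) * (r / max r P))
      = (P + q) * (q * (r / max r q) + P * (r / max r P))"
    by algebra
  also have "\<dots> = (P + q) * (min r q + min r P)"
    using assms by (simp only: mult_divide_max_self)
  finally have "3 / 2 * (q * ((P + q) * (r / max r q)) + P * ((P + q) * (r / max r P)))
      = (P + q) * (3 / 2 * (min r q + min r P))"
    by simp
  also have "\<dots> \<le> (P + q) * (r + (P + q))"
    using assms by (intro mult_left_mono) (auto simp: min_def)
  finally show ?thesis .
qed

lemma abs_diff_ge_from_rays:
  fixes b c P q k m n :: real
  assumes "b \<ge> 0" "c \<ge> 0" "P \<ge> 0" "q > 0"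
    and "m \<le> P + k" and "n \<le> q + k" and "q * m + P * n \<le> (P + q) * k"
  shows "b * m + c * n \<le> \<bar>c * q - b * P\<bar> + (b + c) * k"
proof (cases "b * P \<le> c * q")
  case True
  \<comment> \<open>On this cone \<open>q * (b, c) = b * (q, P) + (c * q - b * P) * (0, 1)\<close>
    has nonnegative coefficients; in the other case
    \<open>P * (b, c) = c * (q, P) + (b * P - c * q) * (1, 0)\<close>.\<close>
  have "0 \<le> b * ((P + q) * k - (q * m + P * n)) + (c * q - b * P) * (q + k - n)"
    using assms True by simp
  also have "\<dots> = q * ((c * q - b * P) + (b + c) * k - (b * m + c * n))"
    by algebra
  finally show ?thesis
    using \<open>q > 0\<close> True by (simp add: zero_le_mult_iff)
next
  case False
  then have "P > 0"
    using assms by (metis linorder_not_le mult_nonneg_nonneg mult_zero_right order_less_le)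
  have "0 \<le> c * ((P + q) * k - (q * m + P * n)) + (b * P - c * q) * (P + k - m)"
    using assms False by simp
  also have "\<dots> = P * ((b * P - c * q) + (b + c) * k - (b * m + c * n))"
    by algebra
  finally show ?thesis
    using \<open>P > 0\<close> False by (simp add: zero_le_mult_iff)
qed

lemma barycentric_bound_nonpos:
  fixes a b c p q r :: real
  assumes "a \<ge> 0" "b \<ge> 0" "c \<ge> 0" "a + b + c = 1" "p \<le> 0" "q > 0" "r > 0"
  shows "3 / 2 * (a * r + b * ((q - p) * (r / max r q)) + c * ((q - p) * (r / max r \<bar>p\<bar>)))
    \<le> \<bar>b * p + c * q\<bar> + (b + c) * r + (q - p) + 2 * a * r"
proof -
  define P where "P = - p"
  have P: "P \<ge> 0" "\<bar>p\<bar> = P" "q - p = P + q" "b * p + c * q = c * q - b * P"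
    using assms by (simp_all add: P_def)
  \<comment> \<open>On the side \<open>BC\<close>, \<open>r + (P + q)\<close> is the part of the
    distance sum that does not depend on the position: \<open>r\<close> vertically to
    \<open>A\<close>, \<open>P + q\<close> to \<open>B\<close> and \<open>C\<close>
    together.\<close>
  have "b * (3 / 2 * ((P + q) * (r / max r q))) + c * (3 / 2 * ((P + q) * (r / max r P)))
      \<le> \<bar>c * q - b * P\<bar> + (b + c) * (r + (P + q))"
  proof (rule abs_diff_ge_from_rays)
    show "3 / 2 * ((P + q) * (r / max r q)) \<le> P + (r + (P + q))"
      using assms P by (intro base_vertex_bound) auto
    show "3 / 2 * ((P + q) * (r / max r P)) \<le> q + (r + (P + q))"
      using base_vertex_bound[of q P r] assms P by (simp add: add.commute)
    show "q * (3 / 2 * ((P + q) * (r / max r q))) + P * (3 / 2 * ((P + q) * (r / max r P)))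
        \<le> (P + q) * (r + (P + q))"
      using altitude_foot_bound[of P q r] assms P
      by (simp only: mult.left_commute[of _ "3 / 2"] distrib_left)
  qed (use assms P in auto)
  moreover have "(b + c) * (r + (P + q)) = (b + c) * r + (P + q) - a * (P + q)"
    using \<open>a + b + c = 1\<close> by algebra
  moreover have "0 \<le> a * (P + q)" "0 \<le> a * r"
    using assms P by simp_all
  ultimately show ?thesis
    unfolding P mult.left_commute[of _ "3 / 2"] distrib_left[of "3 / 2"] by linarith
qed

text \<open>Both sides are linear in the weights once the constants are multiplied by
  \<open>a + b + c\<close>, so the coefficients of \<open>a\<close>, \<open>b\<close> and
  \<open>c\<close> are compared separately.\<close>

lemma barycentric_bound_pos:
  fixes a b c p q r :: real
  assumes "a \<ge> 0" "b \<ge> 0" "c \<ge> 0" "a + b + c = 1" "0 < p" "p < q" "r > 0"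
  shows "3 / 2 * (a * r + b * ((q - p) * (r / max r q)) + c * ((q - p) * (r / max r p)))
    \<le> q + (b * p + c * q - p) + (b + c) * r + 2 * a * r"
proof -
  have "(q - p) * (r / max r q) \<le> q * (r / max r q)"
    using assms by (intro mult_right_mono) (auto simp: max_def)
  also have "\<dots> = min r q"
    using assms by (simp only: mult_divide_max_self)
  finally have "3 / 2 * ((q - p) * (r / max r q)) \<le> q + r"
    using assms by (simp add: min_def split: if_splits)
  then have "b * (3 / 2 * ((q - p) * (r / max r q))) \<le> b * (q + r)"
    using assms by (intro mult_left_mono)
  moreover have "(q - p) * (r / max r p) \<le> q - p"
    using divide_max_le_1[of r p] assms by (intro mult_left_le) auto
  then have "c * (3 / 2 * ((q - p) * (r / max r p))) \<le> c * (q + (q - p) + r)"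
    using assms by (intro mult_left_mono) auto
  moreover have "q + (b * p + c * q - p) + (b + c) * r
      = a * (q - p) + b * (q + r) + c * (q + (q - p) + r)"
    using \<open>a + b + c = 1\<close> by algebra
  moreover have "0 \<le> a * (q - p)" "0 \<le> a * r"
    using assms by simp_all
  ultimately show ?thesis
    unfolding mult.left_commute[of _ "3 / 2"] distrib_left[of "3 / 2"] by linarith
qed

theorem theorem2:
  fixes p q r :: real and A B C M :: "real \<times> real"
  assumes "p < q" and "q > 0" and "r > 0"
    and "A = (0, r)" and "B = (p, 0)" and "C = (q, 0)"
    and "M \<in> interior (convex hull {A, B, C})"
  shows "taxi_dist M A + taxi_dist M B + taxi_dist M C
    \<ge> 3 / 2 * (taxi_dist_line M B C + taxi_dist_line M A C + taxi_dist_line M A B)"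
proof -
  have "M \<in> convex hull {A, B, C}"
    using assms interior_subset by blast
  then obtain a b c where abc: "a \<ge> 0" "b \<ge> 0" "c \<ge> 0" "a + b + c = 1"
    and "M = a *\<^sub>R A + b *\<^sub>R B + c *\<^sub>R C"
    by (auto simp: convex_hull_3)
  then have M: "M = (b * p + c * q, a * r)"
    using assms by simp
  have a: "a = 1 - b - c"
    using abc by simp
  \<comment> \<open>An affine form vanishing at \<open>A\<close> and \<open>C\<close> equals
    \<open>b\<close> times its value at \<open>B\<close>; likewise for the line \<open>AB\<close>
    with \<open>c\<close> and the vertex \<open>C\<close>.\<close>
  have "q * r - r * (b * p + c * q) - q * (a * r) = b * ((q - p) * r)"
    "p * r - r * (b * p + c * q) - p * (a * r) = - (c * ((q - p) * r))"
    unfolding a by algebra+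
  then have lines: "taxi_dist_line M B C + taxi_dist_line M A C + taxi_dist_line M A B
      = a * r + b * ((q - p) * (r / max r q)) + c * ((q - p) * (r / max r \<bar>p\<bar>))"
    using assms abc unfolding M
    by (simp add: taxi_dist_line_triangle abs_mult)
  \<comment> \<open>The bounds \<open>x \<le> q\<close> and \<open>0 \<le> y \<le> r\<close> resolve
    all absolute values except those of \<open>x\<close> and \<open>x - p\<close>.\<close>
  have "b * p + c * q \<le> (b + c) * q"
    using assms abc by (simp add: distrib_right mult_left_mono)
  moreover have "(b + c) * q \<le> 1 * q"
    using assms abc by (intro mult_right_mono) auto
  ultimately have "b * p + c * q \<le> q"
    by simp
  moreover have "a * r - r = - ((b + c) * r)"
    unfolding a by algebra
  moreover have "0 \<le> (b + c) * r" "0 \<le> a * r"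
    using assms abc by simp_all
  ultimately have points: "taxi_dist M A + taxi_dist M B + taxi_dist M C
      = \<bar>b * p + c * q\<bar> + (b + c) * r + \<bar>b * p + c * q - p\<bar> + (q - (b * p + c * q)) + 2 * a * r"
    using assms unfolding M by (simp add: taxi_dist_def)
  show ?thesis
  proof (cases "p \<le> 0")
    case True
    \<comment> \<open>Now the horizontal distances to \<open>B\<close> and \<open>C\<close> add up
      to \<open>q - p\<close>.\<close>
    have "p \<le> b * p + c * q"
    proof -
      have "b * p + c * q - p = c * q - (a + c) * p"
        unfolding a by algebra
      moreover have "(a + c) * p \<le> 0" "0 \<le> c * q"
        using assms abc True by (auto simp: mult_nonneg_nonpos)
      ultimately show ?thesis
        by linarith
    qed
    then show ?thesis
      using barycentric_bound_nonpos[OF abc True \<open>q > 0\<close> \<open>r > 0\<close>] unfolding lines points by linarith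
  next
    case False
    then have "p > 0" and [simp]: "\<bar>p\<bar> = p"
      by simp_all
    \<comment> \<open>Here \<open>\<bar>x\<bar> + (q - x)\<close> collapses to
      \<open>q\<close>.\<close>
    moreover have "0 \<le> b * p + c * q"
      using assms abc False by simp
    ultimately show ?thesis
      using barycentric_bound_pos[OF abc \<open>p > 0\<close> \<open>p < q\<close> \<open>r > 0\<close>]
      unfolding lines points \<open>\<bar>p\<bar> = p\<close> by linarith
  qed
qed

end
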